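(* Let $m$ be a positive integer and let $W=(m\mathbb{N}+X_m)\cup Y^{(0)}\cup\{a\}$, where $X_m\subseteq\{0,1,\dots,m-1\}$, $Y^{(0)}\subseteq\mathbb{Z}^{-}$ is a finite set with $(Y^{(0)} \bmod m)\subseteq X_m$, and $a$ is an integer with $a\not\equiv x \pmod m$ for every $x\in X_m$. Then there exists a minimal complement to $W$ if and only if there exists a subset $C\subseteq\{0,1,\dots,m-1\}$ such that: (a) $\bigl(C+(X_m\cup\{a\})\bigr) \bmod m=\{0,1,\dots,m-1\}$; (b) for any $c\in C$, $c+a\not\equiv c'+x \pmod m$ for all $c'\in C\setminus\{c\}$ and $x\in X_m$.
   Context: $\mathbb{N}$ is the set of nonnegative integers, $\mathbb{Z}$ the set of integers, $\mathbb{Z}^{-}$ the set of negative integers. For $A,B\subseteq\mathbb{Z}$ and $k\in\mathbb{Z}$, $A+B=\{a+b: a\in A, b\in B\}$ and $kA=\{ka:a\in A\}$. A set $A\subseteq\mathbb{Z}$ is a complement to $B\subseteq\mathbb{Z}$ (in $\mathbb{Z}$) if $A+B=\mathbb{Z}$; it is a minimal complement to $B$ if in addition no proper subset of $A$ is a complement to $B$. For a set $S$ of integers, $S \bmod m=\{r\in\{0,1,\dots,m-1\}: r\equiv s \pmod m \text{ for some } s\in S\}$. *)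

theory Defs
  imports "HOL-Library.Set_Algebras" "HOL-Number_Theory.Cong"
begin

text \<open>
  Sumsets \<open>A + B\<close> and dilates \<open>k *o A\<close> are those of \<^theory>\<open>HOL-Library.Set_Algebras\<close>.
\<close>

definition complement_to :: "int set \<Rightarrow> int set \<Rightarrow> bool" where
  "complement_to A B \<longleftrightarrow> A + B = UNIV"

definition minimal_complement_to :: "int set \<Rightarrow> int set \<Rightarrow> bool" where
  "minimal_complement_to A B \<longleftrightarrow>
     complement_to A B \<and> (\<forall>A'. A' \<subset> A \<longrightarrow> \<not> complement_to A' B)"

definition set_mod :: "int set \<Rightarrow> int \<Rightarrow> int set" where
  "set_mod S m = {r \<in> {0..m - 1}. \<exists>s\<in>S. [r = s] (mod m)}"

end

theory Submission
  imports Defs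
begin

text \<open>
  Modulo \<open>m\<close>, the set \<open>W\<close> consists of the residues in \<open>X\<close>, each realised by a full upward
  progression and by nothing far below it, together with the single element \<open>a\<close> in a residue
  class of its own.

  If \<open>C\<close> satisfies the two conditions, then \<open>C + m\<int>\<close>, taken as the set of integers whose
  residue lies in \<open>C\<close>, is a minimal complement. It is a complement because a residue class
  \<open>c + x\<close> is swept out by progressions starting arbitrarily far down and a class \<open>c + a\<close> by
  translates of \<open>a\<close>. It is minimal because condition (b), together
  with \<open>a\<close> lying outside the classes of \<open>X\<close>, makes \<open>n = (n - a) + a\<close> the only
  representation of an integer \<open>n\<close> whose residue is \<open>c + a\<close> with \<open>c \<in> C\<close>.

  Conversely, from a minimal complement \<open>A\<close> take as \<open>C\<close> the residue classes in which \<open>A\<close> is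
  unbounded below. Since \<open>W\<close> is bounded below, very negative integers can only be represented
  with very negative elements of \<open>A\<close>, and these have residues in \<open>C\<close>
  (\<open>eventually_in_deep_residues\<close>); this gives (a). If (b) failed with
  \<open>c + a \<equiv> c' + x\<close>, then any \<open>\<alpha> \<in> A\<close> of residue \<open>c\<close> would be superfluous: \<open>\<alpha> + a\<close> is
  represented with a much smaller element of \<open>A\<close> of residue \<open>c'\<close>, and every other
  \<open>\<alpha> + w\<close> with a much smaller element of \<open>A\<close> of residue \<open>c\<close> (\<open>represent_from_below\<close>). This
  contradicts the fact that each element of a minimal complement has a sum that only it
  represents (\<open>minimal_complement_private_sum\<close>).
\<close>

lemma complement_to_iff: "complement_to A B \<longleftrightarrow> (\<forall>n. \<exists>\<alpha>\<in>A. n - \<alpha> \<in> B)"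
proof
  assume "complement_to A B"
  then have *: "n \<in> A + B" for n
    by (simp add: complement_to_def)
  show "\<forall>n. \<exists>\<alpha>\<in>A. n - \<alpha> \<in> B"
  proof
    fix n
    from *[of n] show "\<exists>\<alpha>\<in>A. n - \<alpha> \<in> B"
      by (metis add_diff_cancel_left' set_plus_elim)
  qed
next
  assume *: "\<forall>n. \<exists>\<alpha>\<in>A. n - \<alpha> \<in> B"
  have "n \<in> A + B" for n
  proof -
    from * obtain \<alpha> where "\<alpha> \<in> A" "n - \<alpha> \<in> B"
      by blast
    then have "\<alpha> + (n - \<alpha>) \<in> A + B"
      by (rule set_plus_intro)
    then show ?thesis
      by simp
  qed
  then show "complement_to A B"
    by (auto simp: complement_to_def)
qed

text \<open>
  An integer witnessing that \<open>A - {\<alpha>}\<close> is no longer a complement must be a sum \<open>\<alpha> + w\<close>.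
\<close>

lemma minimal_complement_private_sum:
  assumes "minimal_complement_to A B" and "\<alpha> \<in> A"
  obtains w where "w \<in> B" and "\<And>\<beta>. \<beta> \<in> A \<Longrightarrow> \<beta> \<noteq> \<alpha> \<Longrightarrow> \<alpha> + w - \<beta> \<notin> B"
proof -
  have "\<not> complement_to (A - {\<alpha>}) B" and compl: "complement_to A B"
    using assms by (auto simp: minimal_complement_to_def)
  then obtain n where n: "\<And>\<beta>. \<beta> \<in> A \<Longrightarrow> \<beta> \<noteq> \<alpha> \<Longrightarrow> n - \<beta> \<notin> B"
    by (auto simp: complement_to_iff)
  moreover have "n - \<alpha> \<in> B"
    using compl n by (metis complement_to_iff)
  ultimately show thesis
    using that[of "n - \<alpha>"] by simp
qed

lemma in_upward_progressionsI:
  fixes m n x :: int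
  assumes "m > 0" and "x \<in> X" and "[n = x] (mod m)" and "x \<le> n"
  shows "n \<in> m *o \<nat> + X"
proof -
  obtain k where k: "n - x = m * k"
    using assms(3) by (auto simp: cong_iff_dvd_diff)
  have "0 \<le> m * k"
    using k assms(4) by linarith
  then have "k \<ge> 0"
    using assms(1) by (simp add: zero_le_mult_iff)
  then have "k \<in> \<nat>"
    by (metis Nats_def nonneg_int_cases rangeI)
  then have "m * k + x \<in> m *o \<nat> + X"
    using assms(2) by (intro set_plus_intro set_times_intro2)
  then show ?thesis
    using k by (simp add: algebra_simps)
qed

lemma upward_progressionsE:
  fixes m n :: int
  assumes "n \<in> m *o \<nat> + X"
  obtains x k where "x \<in> X" and "k \<ge> 0" and "n = m * k + x"
proof -
  obtain b x where "b \<in> m *o \<nat>" "x \<in> X" "n = b + x"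
    using assms by (rule set_plus_elim)
  moreover then obtain k where "b = m * int k"
    by (auto simp: elt_set_times_def Nats_def)
  ultimately show thesis
    using that[of x "int k"] by simp
qed

definition deep_residues :: "int \<Rightarrow> int set \<Rightarrow> int set" where
  "deep_residues m A = {c \<in> {0..m - 1}. \<forall>N. \<exists>\<alpha>\<in>A. \<alpha> \<le> N \<and> [\<alpha> = c] (mod m)}"

text \<open>
  Each of the finitely many other residue classes meets \<open>A\<close> in a set bounded below, so one bound
  serves for all of them.
\<close>

lemma eventually_in_deep_residues:
  assumes "m > 0"
  obtains N where "\<And>\<alpha>. \<alpha> \<in> A \<Longrightarrow> \<alpha> \<le> N \<Longrightarrow> \<alpha> mod m \<in> deep_residues m A"
proof -
  let ?R = "{0..m - 1} - deep_residues m A"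
  have "\<forall>c\<in>?R. \<exists>N. \<forall>\<alpha>\<in>A. \<alpha> \<le> N \<longrightarrow> \<not> [\<alpha> = c] (mod m)"
    by (auto simp: deep_residues_def)
  then obtain b where b: "\<And>c \<alpha>. c \<in> ?R \<Longrightarrow> \<alpha> \<in> A \<Longrightarrow> \<alpha> \<le> b c \<Longrightarrow> \<not> [\<alpha> = c] (mod m)"
    by metis
  define N where "N = Min (insert 0 (b ` ?R))"
  have N: "N \<le> b c" if "c \<in> ?R" for c
    unfolding N_def using that by (intro Min_le) auto
  show thesis
  proof (rule that)
    fix \<alpha> assume "\<alpha> \<in> A" "\<alpha> \<le> N"
    show "\<alpha> mod m \<in> deep_residues m A"
    proof (rule ccontr)
      assume "\<alpha> mod m \<notin> deep_residues m A"
      then have R: "\<alpha> mod m \<in> ?R"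
        using assms by simp
      have "\<alpha> \<le> b (\<alpha> mod m)"
        using N[OF R] \<open>\<alpha> \<le> N\<close> by linarith
      from b[OF R \<open>\<alpha> \<in> A\<close> this] show False
        by (simp add: cong_def)
    qed
  qed
qed

text \<open>
  A deep residue class supplies elements of \<open>A\<close> below any bound, so the progressions started from
  them reach every integer of the class \<open>c + x\<close>. The free bound \<open>N\<close> lets the representation avoid
  any prescribed element of \<open>A\<close>.
\<close>

lemma represent_from_below:
  assumes "m > 0" and "c \<in> deep_residues m A" and "x \<in> X" and "[n = c + x] (mod m)"
  obtains \<alpha> where "\<alpha> \<in> A" and "\<alpha> \<le> N" and "n - \<alpha> \<in> m *o \<nat> + X"
proof -
  obtain \<alpha> where \<alpha>: "\<alpha> \<in> A" "\<alpha> \<le> min N (n - x)" "[\<alpha> = c] (mod m)"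
    using assms(2) unfolding deep_residues_def by blast
  have "[n - \<alpha> = c + x - c] (mod m)"
    using assms(4) \<alpha>(3) by (rule cong_diff)
  then have "n - \<alpha> \<in> m *o \<nat> + X"
    using assms(1,3) \<alpha>(2) by (intro in_upward_progressionsI[where x = x]) auto
  then show thesis
    using \<alpha> that by simp
qed

theorem corollary2:
  fixes m a :: int and X Y W :: "int set"
  assumes "m > 0"
    and "X \<subseteq> {0..m - 1}"
    and "finite Y"
    and "Y \<subseteq> {..<0}"
    and "set_mod Y m \<subseteq> X"
    and "\<forall>x\<in>X. \<not> [a = x] (mod m)"
    and "W = (m *o \<nat> + X) \<union> Y \<union> {a}"
  shows "(\<exists>A. minimal_complement_to A W) \<longleftrightarrow>
    (\<exists>C \<subseteq> {0..m - 1}.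
      set_mod (C + (X \<union> {a})) m = {0..m - 1} \<and>
      (\<forall>c\<in>C. \<forall>c'\<in>C - {c}. \<forall>x\<in>X. \<not> [c + a = c' + x] (mod m)))"
proof -
  have W_residue: "\<exists>x\<in>X. [w = x] (mod m)" if "w \<in> W" "w \<noteq> a" for w
  proof -
    consider "w \<in> m *o \<nat> + X" | "w \<in> Y"
      using \<open>w \<in> W\<close> \<open>w \<noteq> a\<close> assms(7) by auto
    then show ?thesis
    proof cases
      case 1
      then show ?thesis
        by (elim upward_progressionsE) (auto simp: cong_def)
    next
      case 2
      then have "w mod m \<in> set_mod Y m"
        using assms(1) by (auto simp: set_mod_def cong_def intro!: bexI[of _ w])
      then show ?thesis
        using assms(5) by (intro bexI[of _ "w mod m"]) (auto simp: cong_def)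
    qed
  qed
  define L where "L = Min (insert 0 (insert a Y))"
  have W_bound: "L \<le> w" if "w \<in> W" for w
  proof -
    have least: "L \<le> v" if "v \<in> insert 0 (insert a Y)" for v
      unfolding L_def using that assms(3) by (intro Min_le) auto
    show ?thesis
    proof (cases "w \<in> m *o \<nat> + X")
      case True
      then obtain x k where "x \<in> X" "k \<ge> 0" "w = m * k + x"
        by (rule upward_progressionsE)
      then have "0 \<le> w"
        using assms(1,2) by (auto intro!: add_nonneg_nonneg)
      then show ?thesis
        using least[of 0] by simp
    next
      case False
      then show ?thesis
        using that assms(7) least by auto
    qed
  qed
  show ?thesis
  proof
    assume "\<exists>A. minimal_complement_to A W"
    then obtain A where min: "minimal_complement_to A W"
      by blast
    then have compl: "\<And>n. \<exists>\<alpha>\<in>A. n - \<alpha> \<in> W"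
      by (simp add: minimal_complement_to_def complement_to_iff)
    let ?C = "deep_residues m A"
    have "r \<in> set_mod (?C + (X \<union> {a})) m" if r: "r \<in> {0..m - 1}" for r
    proof -
      obtain N where N: "\<And>\<alpha>. \<alpha> \<in> A \<Longrightarrow> \<alpha> \<le> N \<Longrightarrow> \<alpha> mod m \<in> ?C"
        using eventually_in_deep_residues[OF assms(1)] by blast
      \<comment> \<open>An integer of residue \<open>r\<close> so small that every representation of it uses an element
        of \<open>A\<close> below \<open>N\<close>.\<close>
      define K where "K = \<bar>r\<bar> + \<bar>N\<bar> + \<bar>L\<bar>"
      define n where "n = r - m * K"
      have "1 * K \<le> m * K"
        using assms(1) by (intro mult_right_mono) (auto simp: K_def)
      then have "n \<le> r - K"
        by (simp add: n_def)
      also have "r - K \<le> N + L"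
        unfolding K_def by linarith
      finally have "n \<le> N + L" .
      obtain \<alpha> where \<alpha>: "\<alpha> \<in> A" "n - \<alpha> \<in> W"
        using compl by blast
      have "\<alpha> mod m \<in> ?C"
        using W_bound[OF \<alpha>(2)] \<open>n \<le> N + L\<close> by (intro N \<alpha>(1)) linarith
      obtain y where y: "y \<in> X \<union> {a}" "[n - \<alpha> = y] (mod m)"
        using W_residue[OF \<alpha>(2)] by (metis UnCI cong_refl singletonI)
      have "[\<alpha> mod m + y = \<alpha> + (n - \<alpha>)] (mod m)"
        using y(2) by (intro cong_add) (auto simp: cong_def)
      moreover have "[n = r] (mod m)"
        by (simp add: n_def cong_iff_dvd_diff)
      ultimately have "[r = \<alpha> mod m + y] (mod m)"
        by (simp add: cong_def)
      then show ?thesis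
        using r \<open>\<alpha> mod m \<in> ?C\<close> y(1) unfolding set_mod_def by blast
    qed
    then have "set_mod (?C + (X \<union> {a})) m = {0..m - 1}"
      by (auto simp: set_mod_def)
    moreover have "\<not> [c + a = c' + x] (mod m)"
      if c: "c \<in> ?C" and c': "c' \<in> ?C - {c}" and x: "x \<in> X" for c c' x
    proof
      assume clash: "[c + a = c' + x] (mod m)"
      obtain \<alpha> where \<alpha>: "\<alpha> \<in> A" "[\<alpha> = c] (mod m)"
        using c by (auto simp: deep_residues_def)
      obtain w where w: "w \<in> W" and only_\<alpha>: "\<And>\<beta>. \<beta> \<in> A \<Longrightarrow> \<beta> \<noteq> \<alpha> \<Longrightarrow> \<alpha> + w - \<beta> \<notin> W"
        using minimal_complement_private_sum[OF min \<alpha>(1)] by blast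
      obtain d z where dz: "d \<in> ?C" "z \<in> X" "[\<alpha> + w = d + z] (mod m)"
      proof (cases "w = a")
        case True
        have "[\<alpha> + a = c + a] (mod m)"
          using \<alpha>(2) by (intro cong_add) auto
        then show thesis
          using that[of c' x] c' x clash True by (auto intro: cong_trans)
      next
        case False
        then obtain z where "z \<in> X" "[w = z] (mod m)"
          using W_residue[OF w] by blast
        then show thesis
          using that[of c z] c \<alpha>(2) by (simp add: cong_add)
      qed
      obtain \<beta> where "\<beta> \<in> A" "\<beta> \<le> \<alpha> - 1" "\<alpha> + w - \<beta> \<in> m *o \<nat> + X"
        using represent_from_below[OF assms(1) dz] .
      then show False
        using only_\<alpha>[of \<beta>] assms(7) by auto
    qed
    ultimately show "\<exists>C\<subseteq>{0..m - 1}. set_mod (C + (X \<union> {a})) m = {0..m - 1} \<and>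
        (\<forall>c\<in>C. \<forall>c'\<in>C - {c}. \<forall>x\<in>X. \<not> [c + a = c' + x] (mod m))"
      by (intro exI[of _ ?C]) (auto simp: deep_residues_def)
  next
    assume "\<exists>C\<subseteq>{0..m - 1}. set_mod (C + (X \<union> {a})) m = {0..m - 1} \<and>
        (\<forall>c\<in>C. \<forall>c'\<in>C - {c}. \<forall>x\<in>X. \<not> [c + a = c' + x] (mod m))"
    then obtain C where C: "C \<subseteq> {0..m - 1}"
      and cover: "set_mod (C + (X \<union> {a})) m = {0..m - 1}"
      and no_clash: "\<And>c c' x. c \<in> C \<Longrightarrow> c' \<in> C \<Longrightarrow> c' \<noteq> c \<Longrightarrow> x \<in> X \<Longrightarrow> \<not> [c + a = c' + x] (mod m)"
      by blast
    define A where "A = {n. n mod m \<in> C}"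
    have mod_C: "c mod m = c" if "c \<in> C" for c
      using that C by auto
    have deep: "c \<in> deep_residues m A" if "c \<in> C" for c
    proof -
      have "\<exists>\<alpha>\<in>A. \<alpha> \<le> N \<and> [\<alpha> = c] (mod m)" for N
      proof
        define K where "K = \<bar>c\<bar> + \<bar>N\<bar>"
        let ?\<alpha> = "c - m * K"
        have "1 * K \<le> m * K"
          using assms(1) by (intro mult_right_mono) (auto simp: K_def)
        then have "?\<alpha> \<le> c - K"
          by simp
        also have "c - K \<le> N"
          unfolding K_def by linarith
        finally have "?\<alpha> \<le> N" .
        moreover have cong: "[?\<alpha> = c] (mod m)"
          by (simp add: cong_iff_dvd_diff)
        ultimately show "?\<alpha> \<le> N \<and> [?\<alpha> = c] (mod m)"
          by simp
        show "?\<alpha> \<in> A"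
          using cong that mod_C by (simp add: A_def cong_def)
      qed
      then show ?thesis
        using C that by (auto simp: deep_residues_def)
    qed
    have "\<exists>\<alpha>\<in>A. n - \<alpha> \<in> W" for n
    proof -
      have "n mod m \<in> set_mod (C + (X \<union> {a})) m"
        using cover assms(1) by simp
      then obtain c y where cy: "c \<in> C" "y \<in> X \<union> {a}" "[n mod m = c + y] (mod m)"
        by (auto simp: set_mod_def elim!: set_plus_elim)
      then have n: "[n = c + y] (mod m)"
        by (simp add: cong_def)
      show ?thesis
      proof (cases "y = a")
        case True
        have "[n - a = c + a - a] (mod m)"
          using n True by (intro cong_diff) auto
        then have "n - a \<in> A"
          using cy(1) mod_C by (simp add: A_def cong_def)
        then show ?thesis
          using assms(7) by (intro bexI[of _ "n - a"]) auto
      next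
        case False
        then have "y \<in> X"
          using cy(2) by simp
        from represent_from_below[OF assms(1) deep[OF cy(1)] this n] show ?thesis
          using assms(7) by blast
      qed
    qed
    then have "complement_to A W"
      by (simp add: complement_to_iff)
    moreover have "\<not> complement_to A' W" if sub: "A' \<subset> A" for A'
    proof
      assume "complement_to A' W"
      obtain \<alpha> where \<alpha>: "\<alpha> \<in> A" "\<alpha> \<notin> A'"
        using sub by blast
      \<comment> \<open>The sum \<open>\<alpha> + a\<close> is the one that is lost with \<open>\<alpha>\<close>.\<close>
      obtain \<beta> where \<beta>: "\<beta> \<in> A'" "\<alpha> + a - \<beta> \<in> W"
        using \<open>complement_to A' W\<close> unfolding complement_to_iff by blast
      have "\<alpha> + a - \<beta> \<noteq> a"
        using \<alpha> \<beta> by auto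
      then obtain x where x: "x \<in> X" "[\<alpha> + a - \<beta> = x] (mod m)"
        using W_residue \<beta>(2) by blast
      have "[\<alpha> + a - \<beta> + \<beta> = x + \<beta>] (mod m)"
        using x(2) by (intro cong_add) auto
      then have eq: "[\<alpha> mod m + a = \<beta> mod m + x] (mod m)"
        by (simp add: cong_def algebra_simps mod_simps)
      have in_C: "\<alpha> mod m \<in> C" "\<beta> mod m \<in> C"
        using \<alpha>(1) \<beta>(1) sub by (auto simp: A_def)
      show False
      proof (cases "\<beta> mod m = \<alpha> mod m")
        case True
        then have "[a = x] (mod m)"
          using eq by (simp add: cong_add_lcancel)
        then show False
          using assms(6) x(1) by blast
      next
        case False
        then show False
          using no_clash[OF in_C] x(1) eq by blast
      qed
    qed
    ultimately show "\<exists>A. minimal_complement_to A W"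
      by (auto simp: minimal_complement_to_def)
  qed
qed

end
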